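(* Let $m=m_n\to\infty$ and $p=p_n\to0$ satisfy $np=o(1)$. Let $$\hat q=1-(1-p)^n-np(1-p)^{n-1},\qquad \bar{p}=1-e^{-m\hat q/\binom{n}{2}}.$$ Then for any $\delta>0$, the random graphs $\mathcal{G}(n,m,p)$ and $G(n,\bar p)$ can be defined on a common probability space such that with high probability $$\operatorname{mod}(\mathcal{G}(n,m,p))=(1+o(1))\operatorname{mod}(G(n,\bar p))+O((np)^{1-\delta}).$$
   Context: The random intersection graph $\mathcal{G}(n,m,p)$: there is a vertex set $\mathcal{V}=\{v_1,\dots,v_n\}$ and an attribute set $\mathcal{W}=\{w_1,\dots,w_m\}$. Each vertex $v_i$ receives a random subset $\mathcal{W}(v_i)\subseteq\mathcal{W}$, where each attribute is included independently with probability $p$ (independently over all vertex–attribute pairs). Two distinct vertices are adjacent iff their attribute sets intersect. $G(n,\bar p)$ is the Erdős–Rényi random graph on $n$ vertices with each edge present independently with probability $\bar p$. Modularity: for a graph $G$ with at least one edge, $e(G)$ is its number of edges, $e(S)$ the number of edges inside $S\subseteq V(G)$, $\operatorname{vol}(S)$ the sum of degrees of vertices of $S$, $\operatorname{vol}(G)=\operatorname{vol}(V(G))$; $\operatorname{mod}(G)=\max_{\mathcal{A}}\sum_{S\in\mathcal{A}}\left(\frac{e(S)}{e(G)}-\left(\frac{\operatorname{vol}(S)}{\operatorname{vol}(G)}\right)^2\right)$ over all partitions $\mathcal{A}$ of $V(G)$. "With high probability" means with probability tending to $1$ as $n\to\infty$. *)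

theory Defs
  imports "HOL-Probability.Probability" "HOL-Library.Disjoint_Sets" "HOL-Library.Landau_Symbols"
begin

text \<open>A finite simple graph is given by its vertex set \<open>V\<close> and its edge set \<open>E\<close>, a set of
  two-element subsets of \<open>V\<close>.\<close>

definition all_edges :: "'a set \<Rightarrow> 'a set set" where
  "all_edges V = {e. e \<subseteq> V \<and> card e = 2}"

definition edges_inside :: "'a set set \<Rightarrow> 'a set \<Rightarrow> nat" where
  "edges_inside E S = card {e \<in> E. e \<subseteq> S}"

definition degree :: "'a set set \<Rightarrow> 'a \<Rightarrow> nat" where
  "degree E v = card {e \<in> E. v \<in> e}"

definition vol :: "'a set set \<Rightarrow> 'a set \<Rightarrow> nat" where
  "vol E S = (\<Sum>v\<in>S. degree E v)"

definition modularity_score :: "'a set \<Rightarrow> 'a set set \<Rightarrow> 'a set set \<Rightarrow> real" where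
  "modularity_score V E \<A> =
     (\<Sum>S\<in>\<A>. real (edges_inside E S) / real (card E) - (real (vol E S) / real (vol E V))\<^sup>2)"

text \<open>The maximum is over a finite nonempty set whenever \<open>V\<close> is finite. For a graph without
  edges all quotients are \<open>0 / 0 = 0\<close>, so its modularity is \<open>0\<close>.\<close>

definition modularity :: "'a set \<Rightarrow> 'a set set \<Rightarrow> real" where
  "modularity V E = Max (modularity_score V E ` {\<A>. partition_on V \<A>})"

text \<open>The vertices are \<open>0, \<dots>, n - 1\<close> and the attributes are \<open>0, \<dots>, m - 1\<close>; \<open>B (v, w)\<close> says
  that vertex \<open>v\<close> has attribute \<open>w\<close>. The random graphs below are laws of edge sets on the
  deterministic vertex set \<open>{..<n}\<close>.\<close>

definition attributes :: "nat \<Rightarrow> (nat \<times> nat \<Rightarrow> bool) \<Rightarrow> nat \<Rightarrow> nat set" where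
  "attributes m B v = {w. w < m \<and> B (v, w)}"

definition intersection_edges :: "nat \<Rightarrow> nat \<Rightarrow> (nat \<times> nat \<Rightarrow> bool) \<Rightarrow> nat set set" where
  "intersection_edges n m B =
     {{u, v} | u v. u < n \<and> v < n \<and> u \<noteq> v \<and> attributes m B u \<inter> attributes m B v \<noteq> {}}"

definition random_intersection_graph :: "nat \<Rightarrow> nat \<Rightarrow> real \<Rightarrow> nat set set pmf" where
  "random_intersection_graph n m p =
     map_pmf (intersection_edges n m) (Pi_pmf ({..<n} \<times> {..<m}) False (\<lambda>_. bernoulli_pmf p))"

definition erdos_renyi_graph :: "nat \<Rightarrow> real \<Rightarrow> nat set set pmf" where
  "erdos_renyi_graph n p =
     map_pmf (\<lambda>f. {e \<in> all_edges {..<n}. f e})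
       (Pi_pmf (all_edges {..<n}) False (\<lambda>_. bernoulli_pmf p))"

definition q_hat :: "nat \<Rightarrow> real \<Rightarrow> real" where
  "q_hat n p = 1 - (1 - p) ^ n - real n * p * (1 - p) ^ (n - 1)"

definition p_bar :: "nat \<Rightarrow> nat \<Rightarrow> real \<Rightarrow> real" where
  "p_bar n m p = 1 - exp (- (real m * q_hat n p / real (n choose 2)))"

end

theory Submission
  imports Defs
begin

text \<open>Couple attribute by attribute. Let \<open>K\<close> be the clique on the vertices holding a given
  attribute and \<open>F\<close> the random edge set in which every pair appears independently with probability
  \<open>1 - exp (- l)\<close>, where \<open>l = q_hat n p / (n choose 2)\<close>. The union of \<open>m\<close> independent copies of \<open>K\<close> is
  the intersection graph, that of \<open>m\<close> copies of \<open>F\<close> is the binomial graph with edge probability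
  \<open>p_bar n m p\<close>. Both \<open>K\<close> and \<open>F\<close> equal a given singleton \<open>{e}\<close> with probability
  \<open>p\<^sup>2 (1 - O(n p))\<close>, so under a coupling that is maximal on the diagonal \<open>e\<close> lies in exactly one of them with
  probability \<open>O(n p) p\<^sup>2\<close>. For \<open>e\<close> to distinguish the two unions it must moreover be missing from
  all other copies of one kind, which costs a factor \<open>exp (- (m - 1) l)\<close> and keeps the bound at
  \<open>O(n p) * p_bar n m p\<close> even when the graphs are nearly complete. Hence the expected size of the
  symmetric difference is \<open>O(n p)\<close> times the expected number \<open>\<mu>\<close> of edges. If \<open>\<mu>\<close> is small the
  graphs coincide with high probability; otherwise the number of edges is of order \<open>\<mu>\<close> and Markov's
  inequality bounds the relative difference, hence the change of modularity, by \<open>(n p) powr (1 - \<delta>)\<close>.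
  The multiplicative error can be taken to be zero.\<close>

subsection \<open>Products and couplings of probability mass functions\<close>

text \<open>Fubini for finite products: on the support both sides are the same double product of
  point masses. It splits the vertex-attribute table into independent columns, one per
  attribute.\<close>

lemma Pi_pmf_Times:
  assumes A: "finite A" and B: "finite B"
  shows "Pi_pmf (A \<times> B) d p =
    map_pmf (\<lambda>g (x, y). g y x) (Pi_pmf B (\<lambda>_. d) (\<lambda>y. Pi_pmf A d (\<lambda>x. p (x, y))))"
proof (rule pmf_eqI)
  fix f :: "'a \<times> 'b \<Rightarrow> 'c"
  define \<Phi> :: "('b \<Rightarrow> 'a \<Rightarrow> 'c) \<Rightarrow> 'a \<times> 'b \<Rightarrow> 'c" where "\<Phi> = (\<lambda>g (x, y). g y x)"
  define g where "g = (\<lambda>y x. f (x, y))"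
  have inj: "inj \<Phi>"
    by (auto simp: \<Phi>_def inj_def fun_eq_iff)
  have f: "f = \<Phi> g" by (auto simp: \<Phi>_def g_def)
  have "pmf (map_pmf \<Phi> (Pi_pmf B (\<lambda>_. d) (\<lambda>y. Pi_pmf A d (\<lambda>x. p (x, y))))) f =
      pmf (Pi_pmf B (\<lambda>_. d) (\<lambda>y. Pi_pmf A d (\<lambda>x. p (x, y)))) g"
    unfolding f by (rule pmf_map_inj'[OF inj])
  also have "\<dots> = pmf (Pi_pmf (A \<times> B) d p) f"
  proof (cases "\<forall>z. z \<notin> A \<times> B \<longrightarrow> f z = d")
    case True
    then have "pmf (Pi_pmf (A \<times> B) d p) f = (\<Prod>x\<in>A. \<Prod>y\<in>B. pmf (p (x, y)) (f (x, y)))"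
      using A B by (simp add: pmf_Pi prod.cartesian_product)
    also have "\<dots> = (\<Prod>y\<in>B. \<Prod>x\<in>A. pmf (p (x, y)) (f (x, y)))"
      by (rule prod.swap)
    also have "\<dots> = pmf (Pi_pmf B (\<lambda>_. d) (\<lambda>y. Pi_pmf A d (\<lambda>x. p (x, y)))) g"
      using True A B by (auto simp: pmf_Pi g_def intro!: prod.cong)
    finally show ?thesis by simp
  next
    case False
    then obtain x y where xy: "(x, y) \<notin> A \<times> B" "f (x, y) \<noteq> d" by auto
    \<comment> \<open>The offending entry sits either in a column with index in \<open>B\<close>,
      whose own factor then vanishes, or in a column outside \<open>B\<close>, which then differs
      from the default \<open>\<lambda>_. d\<close>.\<close>
    have "pmf (Pi_pmf B (\<lambda>_. d) (\<lambda>y. Pi_pmf A d (\<lambda>x. p (x, y)))) g = 0"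
    proof (cases "y \<in> B")
      case True
      then have "x \<notin> A" using xy by auto
      then have "pmf (Pi_pmf A d (\<lambda>x. p (x, y))) (g y) = 0"
        using A xy by (intro pmf_Pi_outside) (auto simp: g_def)
      then have "(\<Prod>y\<in>B. pmf (Pi_pmf A d (\<lambda>x. p (x, y))) (g y)) = 0"
        using B True by (intro prod_zero) auto
      then show ?thesis using B by (simp add: pmf_Pi[OF B])
    next
      case False
      then show ?thesis using B xy by (intro pmf_Pi_outside) (auto simp: g_def fun_eq_iff)
    qed
    moreover have "pmf (Pi_pmf (A \<times> B) d p) f = 0"
      using xy A B by (intro pmf_Pi_outside) auto
    ultimately show ?thesis by simp
  qed
  finally show "pmf (Pi_pmf (A \<times> B) d p) f =
    pmf (map_pmf (\<lambda>g (x, y). g y x) (Pi_pmf B (\<lambda>_. d) (\<lambda>y. Pi_pmf A d (\<lambda>x. p (x, y))))) f"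
    by (simp add: \<Phi>_def)
qed

text \<open>The event is a box, so its probability factors over \<open>A\<close>; coordinates
  outside \<open>S \<union> T\<close> are unconstrained and contribute 1.\<close>

lemma prob_Pi_pmf_bernoulli:
  assumes "finite A" "S \<subseteq> A" "T \<subseteq> A" "S \<inter> T = {}" "0 \<le> p" "p \<le> 1"
  shows "measure_pmf.prob (Pi_pmf A d (\<lambda>_. bernoulli_pmf p)) {f. (\<forall>x\<in>S. f x) \<and> (\<forall>x\<in>T. \<not> f x)} =
    p ^ card S * (1 - p) ^ card T"
proof -
  define B where "B x = (if x \<in> S then {True} else if x \<in> T then {False} else UNIV)" for x
  have "{f. (\<forall>x\<in>S. f x) \<and> (\<forall>x\<in>T. \<not> f x)} = Pi A B"
  proof (intro set_eqI iffI)
    fix f assume "f \<in> Pi A B"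
    then have "f x \<in> B x" if "x \<in> S \<union> T" for x
      using that assms by (meson Pi_mem UnE subsetD)
    then show "f \<in> {f. (\<forall>x\<in>S. f x) \<and> (\<forall>x\<in>T. \<not> f x)}"
      using assms(4) by (fastforce simp: B_def split: if_split_asm)
  qed (auto simp: B_def)
  then have "measure_pmf.prob (Pi_pmf A d (\<lambda>_. bernoulli_pmf p)) {f. (\<forall>x\<in>S. f x) \<and> (\<forall>x\<in>T. \<not> f x)} =
     (\<Prod>x\<in>A. measure_pmf.prob (bernoulli_pmf p) (B x))"
    using assms by (simp add: measure_Pi_pmf_Pi)
  also have "\<dots> = (\<Prod>x\<in>A. (if x \<in> S then p else 1) * (if x \<in> T then 1 - p else 1))"
    using assms by (intro prod.cong refl) (auto simp: B_def measure_pmf_single)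
  also have "\<dots> = p ^ card S * (1 - p) ^ card T"
    using assms(1-3) by (simp add: prod.distrib flip: prod.inter_restrict) (simp add: Int_absorb1)
  finally show ?thesis .
qed

text \<open>The maximal coupling: the common mass \<open>min (pmf P x) (pmf Q x)\<close> is put on
  the diagonal and the leftovers, each of total mass \<open>t\<close>, are coupled
  independently.\<close>

lemma exists_coupling:
  fixes P Q :: "'a pmf"
  assumes "finite (set_pmf P)" "finite (set_pmf Q)"
  obtains J where "map_pmf fst J = P" "map_pmf snd J = Q"
    "\<And>x. pmf J (x, x) \<ge> min (pmf P x) (pmf Q x)"
proof -
  define \<Omega> where "\<Omega> = set_pmf P \<union> set_pmf Q"
  have fin: "finite \<Omega>" using assms by (simp add: \<Omega>_def)
  have out: "pmf P x = 0" "pmf Q x = 0" if "x \<notin> \<Omega>" for x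
    using that by (auto simp: \<Omega>_def set_pmf_iff)
  define r where "r x = min (pmf P x) (pmf Q x)" for x
  define t where "t = (\<Sum>x\<in>\<Omega>. pmf P x - r x)"
  have sums: "(\<Sum>x\<in>\<Omega>. pmf P x) = 1" "(\<Sum>x\<in>\<Omega>. pmf Q x) = 1"
    using fin by (auto intro!: sum_pmf_eq_1 simp: \<Omega>_def)
  have t': "t = (\<Sum>x\<in>\<Omega>. pmf Q x - r x)"
    by (simp add: t_def sum_subtractf sums)
  have nn: "pmf P x - r x \<ge> 0" "pmf Q x - r x \<ge> 0" "r x \<ge> 0" for x
    by (auto simp: r_def)
  then have t0: "t \<ge> 0" by (auto simp: t_def intro: sum_nonneg)
  \<comment> \<open>If \<open>t = 0\<close> nothing is left over, both laws equal \<open>r\<close>,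
    and the second summand of \<open>j\<close> below is a division by zero, hence
    \<open>0\<close>.\<close>
  have tz: "pmf P x = r x" "pmf Q x = r x" if "t = 0" for x
  proof -
    show "pmf P x = r x"
      using that fin nn out[of x] unfolding t_def
      by (cases "x \<in> \<Omega>") (auto simp: sum_nonneg_eq_0_iff r_def)
    show "pmf Q x = r x"
      using that fin nn out[of x] unfolding t'
      by (cases "x \<in> \<Omega>") (auto simp: sum_nonneg_eq_0_iff r_def)
  qed
  define j where "j = (\<lambda>(x, y). (if x = y then r x else 0) + (pmf P x - r x) * (pmf Q y - r y) / t)"
  have j0: "j z \<ge> 0" for z
    using nn t0 by (auto simp: j_def split: prod.splits)
  have jout: "j z = 0" if "z \<notin> \<Omega> \<times> \<Omega>" for z
    using that out by (cases z) (auto simp: j_def r_def)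
  have row: "(\<Sum>y\<in>\<Omega>. j (x, y)) = pmf P x" if "x \<in> \<Omega>" for x
  proof -
    have "(\<Sum>y\<in>\<Omega>. j (x, y)) = r x + (pmf P x - r x) * (\<Sum>y\<in>\<Omega>. pmf Q y - r y) / t"
      using fin that by (simp add: j_def sum.distrib sum_distrib_left sum_divide_distrib)
    also have "\<dots> = pmf P x" using tz[of x] by (cases "t = 0") (simp_all add: t'[symmetric])
    finally show ?thesis .
  qed
  have col: "(\<Sum>x\<in>\<Omega>. j (x, y)) = pmf Q y" if "y \<in> \<Omega>" for y
  proof -
    have "(\<Sum>x\<in>\<Omega>. j (x, y)) = r y + (\<Sum>x\<in>\<Omega>. pmf P x - r x) * (pmf Q y - r y) / t"
      using fin that by (simp add: j_def sum.distrib sum_distrib_right sum_divide_distrib)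
    also have "\<dots> = pmf Q y" using tz[of y] by (cases "t = 0") (simp_all add: t_def[symmetric])
    finally show ?thesis .
  qed
  have total: "(\<integral>\<^sup>+ z. ennreal (j z) \<partial>count_space UNIV) = 1"
  proof -
    have "(\<integral>\<^sup>+ z. ennreal (j z) \<partial>count_space UNIV) = (\<Sum>z\<in>\<Omega> \<times> \<Omega>. ennreal (j z))"
      using fin by (intro nn_integral_count_space') (simp_all add: jout)
    also have "\<dots> = ennreal (\<Sum>z\<in>\<Omega> \<times> \<Omega>. j z)" using j0 by simp
    also have "(\<Sum>z\<in>\<Omega> \<times> \<Omega>. j z) = (\<Sum>x\<in>\<Omega>. \<Sum>y\<in>\<Omega>. j (x, y))"
      by (simp add: sum.cartesian_product)
    also have "\<dots> = 1" using row sums by simp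
    finally show ?thesis by simp
  qed
  define J where "J = embed_pmf j"
  have J: "pmf J z = j z" for z
    unfolding J_def using j0 total by (intro pmf_embed_pmf) auto
  have sub: "z \<in> \<Omega> \<times> \<Omega>" if "pmf J z \<noteq> 0" for z using jout[of z] that by (metis J)
  have prob: "measure_pmf.prob J X = (\<Sum>z\<in>X \<inter> (\<Omega> \<times> \<Omega>). j z)" for X
  proof -
    have "measure_pmf.prob J X = measure_pmf.prob J (X \<inter> (\<Omega> \<times> \<Omega>))"
      by (intro measure_prob_cong_0) (auto simp: J jout)
    then show ?thesis using fin by (simp add: measure_measure_pmf_finite J)
  qed
  show thesis
  proof
    show "map_pmf fst J = P"
    proof (rule pmf_eqI)
      fix x
      have "pmf (map_pmf fst J) x = (\<Sum>z\<in>fst -` {x} \<inter> (\<Omega> \<times> \<Omega>). j z)"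
        by (simp add: pmf_map prob)
      also have "fst -` {x} \<inter> (\<Omega> \<times> \<Omega>) = (if x \<in> \<Omega> then (\<lambda>y. (x, y)) ` \<Omega> else {})" by auto
      also have "(\<Sum>z\<in>\<dots>. j z) = pmf P x"
        using row[of x] out[of x] by (auto simp: sum.reindex inj_on_def)
      finally show "pmf (map_pmf fst J) x = pmf P x" .
    qed
    show "map_pmf snd J = Q"
    proof (rule pmf_eqI)
      fix x
      have "pmf (map_pmf snd J) x = (\<Sum>z\<in>snd -` {x} \<inter> (\<Omega> \<times> \<Omega>). j z)"
        by (simp add: pmf_map prob)
      also have "snd -` {x} \<inter> (\<Omega> \<times> \<Omega>) = (if x \<in> \<Omega> then (\<lambda>y. (y, x)) ` \<Omega> else {})" by auto
      also have "(\<Sum>z\<in>\<dots>. j z) = pmf Q x"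
        using col[of x] out[of x] by (auto simp: sum.reindex inj_on_def)
      finally show "pmf (map_pmf snd J) x = pmf Q x" .
    qed
    show "pmf J (x, x) \<ge> min (pmf P x) (pmf Q x)" for x
      using nn t0 by (simp add: J j_def r_def[symmetric])
  qed
qed

text \<open>Union bound over the index at which \<open>P\<close> holds. For a fixed index,
  independence gives one factor for the joint event and a factor for \<open>Q\<close> from each of
  the other \<open>m - 1\<close> coordinates.\<close>

lemma prob_Pi_pmf_exists_all_le:
  "measure_pmf.prob (Pi_pmf {..<m::nat} d (\<lambda>_. J)) {k. (\<exists>w<m. P (k w)) \<and> (\<forall>w<m. Q (k w))} \<le>
    real m * measure_pmf.prob J {z. P z \<and> Q z} * measure_pmf.prob J {z. Q z} ^ (m - 1)"
    (is "measure_pmf.prob ?M _ \<le> _")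
proof -
  define X where "X w = Pi {..<m} (\<lambda>w'. if w' = w then {z. P z \<and> Q z} else {z. Q z})" for w
  have "measure_pmf.prob ?M {k. (\<exists>w<m. P (k w)) \<and> (\<forall>w<m. Q (k w))} \<le> measure_pmf.prob ?M (\<Union>w\<in>{..<m}. X w)"
    by (intro measure_pmf.finite_measure_mono) (auto simp: X_def)
  also have "\<dots> \<le> (\<Sum>w<m. measure_pmf.prob ?M (X w))"
    by (intro measure_pmf.finite_measure_subadditive_finite) auto
  also have "\<dots> = (\<Sum>w<m. measure_pmf.prob J {z. P z \<and> Q z} * measure_pmf.prob J {z. Q z} ^ (m - 1))"
  proof (intro sum.cong refl)
    fix w assume w: "w \<in> {..<m}"
    have "measure_pmf.prob ?M (X w) =
      (\<Prod>w'<m. measure_pmf.prob J (if w' = w then {z. P z \<and> Q z} else {z. Q z}))"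
      by (simp add: X_def measure_Pi_pmf_Pi)
    also have "\<dots> = measure_pmf.prob J {z. P z \<and> Q z} * (\<Prod>w'\<in>{..<m} - {w}. measure_pmf.prob J {z. Q z})"
      using w by (subst prod.remove[of _ w]) auto
    finally show "measure_pmf.prob ?M (X w) =
      measure_pmf.prob J {z. P z \<and> Q z} * measure_pmf.prob J {z. Q z} ^ (m - 1)"
      using w by simp
  qed
  finally show ?thesis by simp
qed

text \<open>An element of only one of the unions lies in some component of that kind and in no
  component of the other kind. The latter, demanded at all indices, yields the factor
  \<open>r ^ (m - 1)\<close>.\<close>

lemma prob_mem_sym_diff_UN_le:
  assumes K: "measure_pmf.prob J {(K, F). e \<notin> K} \<le> r" and F: "measure_pmf.prob J {(K, F). e \<notin> F} \<le> r"
  shows "measure_pmf.prob (Pi_pmf {..<m::nat} d (\<lambda>_. J))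
      {k. e \<in> sym_diff (\<Union>w<m. fst (k w)) (\<Union>w<m. snd (k w))} \<le>
    real m * measure_pmf.prob J {(K, F). e \<in> sym_diff K F} * r ^ (m - 1)"
    (is "measure_pmf.prob ?M _ \<le> _")
proof -
  let ?a = "measure_pmf.prob J {z. e \<in> fst z \<and> e \<notin> snd z}"
  let ?b = "measure_pmf.prob J {z. e \<in> snd z \<and> e \<notin> fst z}"
  let ?A = "{k. (\<exists>w<m. e \<in> fst (k w)) \<and> (\<forall>w<m. e \<notin> snd (k w))}"
  let ?B = "{k. (\<exists>w<m. e \<in> snd (k w)) \<and> (\<forall>w<m. e \<notin> fst (k w))}"
  have ab: "measure_pmf.prob J {(K, F). e \<in> sym_diff K F} = ?a + ?b"
    by (subst measure_pmf.finite_measure_Union[symmetric])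
      (auto intro!: arg_cong[where f="measure_pmf.prob J"])
  have "measure_pmf.prob ?M {k. e \<in> sym_diff (\<Union>w<m. fst (k w)) (\<Union>w<m. snd (k w))} \<le>
    measure_pmf.prob ?M (?A \<union> ?B)"
    by (intro measure_pmf.finite_measure_mono) auto
  also have "\<dots> \<le> measure_pmf.prob ?M ?A + measure_pmf.prob ?M ?B"
    by (intro measure_Un_le) auto
  also have "measure_pmf.prob ?M ?A \<le> real m * ?a * measure_pmf.prob J {z. e \<notin> snd z} ^ (m - 1)"
    by (rule prob_Pi_pmf_exists_all_le)
  also have "\<dots> \<le> real m * ?a * r ^ (m - 1)"
    using F by (intro mult_left_mono power_mono) (auto simp: case_prod_unfold)
  also have "measure_pmf.prob ?M ?B \<le> real m * ?b * measure_pmf.prob J {z. e \<notin> fst z} ^ (m - 1)"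
    by (rule prob_Pi_pmf_exists_all_le)
  also have "\<dots> \<le> real m * ?b * r ^ (m - 1)"
    using K by (intro mult_left_mono power_mono) (auto simp: case_prod_unfold)
  also have "real m * ?a * r ^ (m - 1) + real m * ?b * r ^ (m - 1) = real m * (?a + ?b) * r ^ (m - 1)"
    by (simp add: algebra_simps)
  finally show ?thesis unfolding ab by simp
qed

subsection \<open>Both random graphs as unions over attributes\<close>

lemma intersection_edges_eq_UN_all_edges:
  "intersection_edges n m B = (\<Union>w<m. all_edges {v. v < n \<and> B (v, w)})"
proof (intro set_eqI iffI)
  fix e assume "e \<in> intersection_edges n m B"
  then obtain u v w where "e = {u, v}" "u < n" "v < n" "u \<noteq> v" "w < m" "B (u, w)" "B (v, w)"
    unfolding intersection_edges_def attributes_def by blast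
  then show "e \<in> (\<Union>w<m. all_edges {v. v < n \<and> B (v, w)})"
    by (auto simp: all_edges_def intro!: bexI[of _ w])
next
  fix e assume "e \<in> (\<Union>w<m. all_edges {v. v < n \<and> B (v, w)})"
  then obtain w where w: "w < m" "e \<subseteq> {v. v < n \<and> B (v, w)}" "card e = 2"
    by (auto simp: all_edges_def)
  then obtain u v where "e = {u, v}" "u \<noteq> v" by (auto simp: card_2_iff)
  with w show "e \<in> intersection_edges n m B"
    unfolding intersection_edges_def attributes_def by blast
qed

text \<open>The contribution of a single attribute; the edge set is empty when fewer than two
  vertices hold it.\<close>

definition clique_pmf :: "nat \<Rightarrow> real \<Rightarrow> nat set set pmf" where
  "clique_pmf n p =
     map_pmf (\<lambda>f. all_edges {v. v < n \<and> f v}) (Pi_pmf {..<n} False (\<lambda>_. bernoulli_pmf p))"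

lemma random_intersection_graph_eq_UN_clique_pmf:
  "random_intersection_graph n m p =
    map_pmf (\<lambda>k. \<Union>w<m. k w) (Pi_pmf {..<m} {} (\<lambda>_. clique_pmf n p))"
proof -
  let ?f = "\<lambda>f::nat \<Rightarrow> bool. all_edges {v. v < n \<and> f v}"
  \<comment> \<open>\<open>Pi_pmf_map\<close> requires that the default column be carried to the
    default edge set.\<close>
  have "?f (\<lambda>_. False) = {}"
    by (auto simp: all_edges_def)
  then have "Pi_pmf {..<m} {} (\<lambda>_. clique_pmf n p) =
      map_pmf ((\<circ>) ?f) (Pi_pmf {..<m} (\<lambda>_. False) (\<lambda>_. Pi_pmf {..<n} False (\<lambda>_. bernoulli_pmf p)))"
    unfolding clique_pmf_def by (intro Pi_pmf_map) auto
  then show ?thesis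
    by (simp add: random_intersection_graph_def Pi_pmf_Times pmf.map_comp o_def
        intersection_edges_eq_UN_all_edges)
qed

text \<open>Both iterated products are the product over pairs, up to transposition. This turns
  \<open>m\<close> random edge sets into \<open>m\<close> random bits for each edge.\<close>

lemma Pi_pmf_swap:
  assumes A: "finite A" and B: "finite B"
  shows "Pi_pmf B (\<lambda>_. d) (\<lambda>_. Pi_pmf A d (\<lambda>_. P)) =
    map_pmf (\<lambda>g y x. g x y) (Pi_pmf A (\<lambda>_. d) (\<lambda>_. Pi_pmf B d (\<lambda>_. P)))"
proof -
  have "Pi_pmf B (\<lambda>_. d) (\<lambda>_. Pi_pmf A d (\<lambda>_. P)) =
      map_pmf (\<lambda>h y x. h (x, y)) (Pi_pmf (A \<times> B) d (\<lambda>_. P))"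
    using A B by (simp add: Pi_pmf_Times pmf.map_comp o_def)
  also have "Pi_pmf (A \<times> B) d (\<lambda>_. P) = map_pmf (\<lambda>g. g \<circ> prod.swap) (Pi_pmf (B \<times> A) d (\<lambda>_. P))"
    using A B by (intro Pi_pmf_bij_betw) (auto simp: bij_betw_def inj_on_def)
  also have "Pi_pmf (B \<times> A) d (\<lambda>_. P) =
      map_pmf (\<lambda>g (y, x). g x y) (Pi_pmf A (\<lambda>_. d) (\<lambda>_. Pi_pmf B d (\<lambda>_. P)))"
    using A B by (simp add: Pi_pmf_Times)
  finally show ?thesis by (simp add: pmf.map_comp o_def)
qed

text \<open>All \<open>m\<close> bits fail with probability \<open>(1 - q) ^ m\<close>, and a law on
  \<open>bool\<close> is determined by its mass at \<open>False\<close>.\<close>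

lemma map_pmf_ex_bernoulli:
  assumes "0 \<le> q" "q \<le> 1"
  shows "map_pmf (\<lambda>g. \<exists>w<m. g w) (Pi_pmf {..<m::nat} False (\<lambda>_. bernoulli_pmf q)) =
    bernoulli_pmf (1 - (1 - q) ^ m)" (is "?M = _")
proof (rule pmf_eqI)
  have False_case: "pmf ?M False = (1 - q) ^ m"
    using prob_Pi_pmf_bernoulli[of "{..<m}" "{}" "{..<m}" q False] assms
    by (simp add: pmf_map vimage_def Ball_def)
  have "pmf ?M False + pmf ?M True = 1"
    by (simp add: pmf_False_conv_True[of ?M])
  then show "pmf ?M b = pmf (bernoulli_pmf (1 - (1 - q) ^ m)) b" for b
    using False_case assms by (cases b) (simp_all add: power_le_one)
qed

lemma finite_all_edges: "finite V \<Longrightarrow> finite (all_edges V)"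
  by (auto simp: all_edges_def intro: finite_subset[of _ "Pow V"])

lemma card_all_edges: "finite V \<Longrightarrow> card (all_edges V) = card V choose 2"
  by (simp add: all_edges_def n_subsets)

text \<open>A pair is in the union iff one of its \<open>m\<close> bits is true. Exchanging the
  order of the products groups the bits by pair, so distinct pairs stay independent.\<close>

lemma erdos_renyi_graph_eq_UN:
  assumes "0 \<le> q" "q \<le> 1"
  shows "erdos_renyi_graph n (1 - (1 - q) ^ m) =
    map_pmf (\<lambda>k. \<Union>w<m. k w) (Pi_pmf {..<m} {} (\<lambda>_. erdos_renyi_graph n q))"
proof -
  let ?E = "all_edges {..<n}"
  have fin: "finite ?E" by (simp add: finite_all_edges)
  have "Pi_pmf {..<m} {} (\<lambda>_. erdos_renyi_graph n q) =
      map_pmf ((\<circ>) (\<lambda>f. {e \<in> ?E. f e}))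
        (Pi_pmf {..<m} (\<lambda>_. False) (\<lambda>_. Pi_pmf ?E False (\<lambda>_. bernoulli_pmf q)))"
    unfolding erdos_renyi_graph_def by (intro Pi_pmf_map) auto
  then have "map_pmf (\<lambda>k. \<Union>w<m. k w) (Pi_pmf {..<m} {} (\<lambda>_. erdos_renyi_graph n q)) =
      map_pmf (\<lambda>g. \<Union>w<m. {e \<in> ?E. g e w})
        (Pi_pmf ?E (\<lambda>_. False) (\<lambda>_. Pi_pmf {..<m} False (\<lambda>_. bernoulli_pmf q)))"
    by (simp add: Pi_pmf_swap[OF fin] pmf.map_comp o_def)
  also have "\<dots> = map_pmf (\<lambda>f. {e \<in> ?E. f e}) (map_pmf ((\<circ>) (\<lambda>g. \<exists>w<m. g w))
        (Pi_pmf ?E (\<lambda>_. False) (\<lambda>_. Pi_pmf {..<m} False (\<lambda>_. bernoulli_pmf q))))"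
    by (auto simp: pmf.map_comp o_def intro!: map_pmf_cong)
  also have "map_pmf ((\<circ>) (\<lambda>g. \<exists>w<m. g w))
        (Pi_pmf ?E (\<lambda>_. False) (\<lambda>_. Pi_pmf {..<m} False (\<lambda>_. bernoulli_pmf q))) =
      Pi_pmf ?E False (\<lambda>_. bernoulli_pmf (1 - (1 - q) ^ m))"
    unfolding map_pmf_ex_bernoulli[OF assms, symmetric]
    by (rule Pi_pmf_map[symmetric]) (auto simp: fin)
  finally show ?thesis by (simp add: erdos_renyi_graph_def)
qed

lemma set_pmf_erdos_renyi_graph: "set_pmf (erdos_renyi_graph n q) \<subseteq> Pow (all_edges {..<n})"
  by (auto simp: erdos_renyi_graph_def)

lemma set_pmf_clique_pmf: "set_pmf (clique_pmf n p) \<subseteq> Pow (all_edges {..<n})"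
  by (auto simp: clique_pmf_def all_edges_def)

lemma prob_mem_clique_pmf:
  assumes "0 \<le> p" "p \<le> 1" "e \<in> all_edges {..<n}"
  shows "measure_pmf.prob (clique_pmf n p) {K. e \<in> K} = p\<^sup>2"
proof -
  have "{f. e \<in> all_edges {v. v < n \<and> f v}} = {f. (\<forall>v\<in>e. f v) \<and> (\<forall>v\<in>{}. \<not> f v)}"
    using assms by (auto simp: all_edges_def)
  then show ?thesis
    using assms prob_Pi_pmf_bernoulli[of "{..<n}" e "{}" p False]
    by (simp add: clique_pmf_def vimage_def all_edges_def)
qed

text \<open>If the holders of the attribute are exactly the two ends of \<open>e\<close>, the clique
  is the single edge \<open>e\<close>.\<close>

lemma pmf_clique_pmf_singleton_ge:
  assumes "0 \<le> p" "p \<le> 1" "e \<in> all_edges {..<n}"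
  shows "pmf (clique_pmf n p) {e} \<ge> p\<^sup>2 * (1 - p) ^ (n - 2)"
proof -
  have e: "e \<subseteq> {..<n}" "card e = 2" using assms by (auto simp: all_edges_def)
  have "f \<in> (\<lambda>f. all_edges {v. v < n \<and> f v}) -` {{e}}"
    if f: "\<forall>v\<in>e. f v" "\<forall>v\<in>{..<n} - e. \<not> f v" for f
  proof -
    have "{v. v < n \<and> f v} = e" using f e by auto
    moreover have "finite e" using e by (auto intro: finite_subset)
    then have "all_edges e = {e}"
      using card_subset_eq[of e] e by (auto simp: all_edges_def)
    ultimately show ?thesis by simp
  qed
  then have "measure_pmf.prob (Pi_pmf {..<n} False (\<lambda>_. bernoulli_pmf p))
      {f. (\<forall>v\<in>e. f v) \<and> (\<forall>v\<in>{..<n} - e. \<not> f v)} \<le> pmf (clique_pmf n p) {e}"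
    unfolding clique_pmf_def pmf_map by (intro measure_pmf.finite_measure_mono) auto
  moreover have "card ({..<n} - e) = n - 2"
    using e by (subst card_Diff_subset) (auto intro: finite_subset)
  ultimately show ?thesis
    using assms e prob_Pi_pmf_bernoulli[of "{..<n}" e "{..<n} - e" p False] by simp
qed

lemma prob_mem_erdos_renyi_graph:
  assumes "0 \<le> q" "q \<le> 1" "e \<in> all_edges {..<n}"
  shows "measure_pmf.prob (erdos_renyi_graph n q) {F. e \<in> F} = q"
  using assms prob_Pi_pmf_bernoulli[of "all_edges {..<n}" "{e}" "{}" q False]
  by (simp add: erdos_renyi_graph_def vimage_def finite_all_edges)

lemma pmf_erdos_renyi_graph_singleton:
  assumes "0 \<le> q" "q \<le> 1" "e \<in> all_edges {..<n}"
  shows "pmf (erdos_renyi_graph n q) {e} = q * (1 - q) ^ ((n choose 2) - 1)"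
proof -
  have "(\<lambda>f. {e \<in> all_edges {..<n}. f e}) -` {{e}} =
      {f. (\<forall>x\<in>{e}. f x) \<and> (\<forall>x\<in>all_edges {..<n} - {e}. \<not> f x)}"
    using assms by auto
  then show ?thesis
    using assms prob_Pi_pmf_bernoulli[of "all_edges {..<n}" "{e}" "all_edges {..<n} - {e}" q False]
    by (simp add: erdos_renyi_graph_def pmf_map finite_all_edges card_all_edges)
qed

subsection \<open>Stability of modularity\<close>

text \<open>For \<open>h > 0\<close> each difference is
  \<open>c i / (h + d) - a i * (d / (h * (h + d)))\<close>, and either part sums to at most
  \<open>d / (h + d)\<close>. In the applications \<open>i\<close> runs over the blocks of a
  partition, \<open>a\<close> measures the smaller graph and \<open>c\<close> the added
  edges.\<close>

lemma sum_abs_diff_normalised_le: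
  fixes a c :: "'i \<Rightarrow> real"
  assumes "finite I" and a: "\<And>i. i \<in> I \<Longrightarrow> a i \<ge> 0" and c: "\<And>i. i \<in> I \<Longrightarrow> c i \<ge> 0"
    and h: "(\<Sum>i\<in>I. a i) \<le> h" and d: "(\<Sum>i\<in>I. c i) \<le> d"
  shows "(\<Sum>i\<in>I. \<bar>(a i + c i) / (h + d) - a i / h\<bar>) \<le> 2 * d / (h + d)"
proof -
  have sums: "0 \<le> (\<Sum>i\<in>I. a i)" "0 \<le> (\<Sum>i\<in>I. c i)"
    using a c by (auto intro: sum_nonneg)
  then have h0: "h \<ge> 0" and d0: "d \<ge> 0" using h d by linarith+
  \<comment> \<open>An empty smaller graph: \<open>a i / h\<close> is \<open>0\<close> by division
    by zero, and the numerators vanish as well.\<close>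
  have a0: "a i = 0" if "h = 0" "i \<in> I" for i
  proof -
    have "(\<Sum>i\<in>I. a i) = 0" using that h sums by linarith
    then show ?thesis using sum_nonneg_eq_0_iff[OF \<open>finite I\<close>, of a] a that by blast
  qed
  have "\<bar>(a i + c i) / (h + d) - a i / h\<bar> \<le> c i / (h + d) + a i * (d / (h * (h + d)))" if i: "i \<in> I" for i
  proof (cases "h = 0")
    case True
    then show ?thesis using a0[of i] i c[of i] d0 by simp
  next
    case False
    then have "(a i + c i) / (h + d) - a i / h = c i / (h + d) - a i * (d / (h * (h + d)))"
      using h0 d0 by (simp add: divide_simps) (simp add: algebra_simps)
    moreover have "c i / (h + d) \<ge> 0" "a i * (d / (h * (h + d))) \<ge> 0"
      using a[OF i] c[OF i] h0 d0 by auto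
    ultimately show ?thesis by linarith
  qed
  then have "(\<Sum>i\<in>I. \<bar>(a i + c i) / (h + d) - a i / h\<bar>) \<le>
      (\<Sum>i\<in>I. c i / (h + d) + a i * (d / (h * (h + d))))"
    by (intro sum_mono) auto
  also have "\<dots> = (\<Sum>i\<in>I. c i) / (h + d) + (\<Sum>i\<in>I. a i) * (d / (h * (h + d)))"
    by (simp add: sum.distrib sum_divide_distrib sum_distrib_right)
  also have "\<dots> \<le> d / (h + d) + h * (d / (h * (h + d)))"
    using h d h0 d0 by (intro add_mono divide_right_mono mult_right_mono) auto
  also have "h * (d / (h * (h + d))) \<le> d / (h + d)"
    using h0 d0 by (cases "h = 0") auto
  finally show ?thesis by simp
qed

lemma degree_Diff:
  assumes "finite L" "H \<subseteq> L"
  shows "degree L v = degree H v + degree (L - H) v"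
proof -
  have "{e \<in> L. v \<in> e} = {e \<in> H. v \<in> e} \<union> {e \<in> L - H. v \<in> e}" using assms by auto
  then show ?thesis
    unfolding degree_def using assms finite_subset[OF assms(2,1)]
    by (simp add: card_Un_disjoint disjoint_iff)
qed

lemma edges_inside_Diff:
  assumes "finite L" "H \<subseteq> L"
  shows "edges_inside L S = edges_inside H S + edges_inside (L - H) S"
proof -
  have "{e \<in> L. e \<subseteq> S} = {e \<in> H. e \<subseteq> S} \<union> {e \<in> L - H. e \<subseteq> S}" using assms by auto
  then show ?thesis
    unfolding edges_inside_def using assms finite_subset[OF assms(2,1)]
    by (simp add: card_Un_disjoint disjoint_iff)
qed

lemma vol_Diff:
  assumes "finite L" "H \<subseteq> L"
  shows "vol L S = vol H S + vol (L - H) S"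
  using degree_Diff[OF assms] by (simp add: vol_def sum.distrib)

text \<open>Handshaking: incidences are counted by vertices and by edges.\<close>

lemma vol_all:
  assumes "finite V" "E \<subseteq> all_edges V"
  shows "vol E V = 2 * card E"
proof -
  have fin: "finite E" using assms finite_subset[of E "Pow V"] by (auto simp: all_edges_def)
  have "vol E V = (\<Sum>v\<in>V. \<Sum>e\<in>E. if v \<in> e then 1 else 0)"
    using fin by (simp add: vol_def degree_def sum.If_cases Int_def)
  also have "\<dots> = (\<Sum>e\<in>E. \<Sum>v\<in>V. if v \<in> e then 1 else 0)"
    by (rule sum.swap)
  also have "\<dots> = (\<Sum>e\<in>E. card e)"
    using assms by (intro sum.cong refl) (auto simp: all_edges_def sum.If_cases Int_absorb1)
  also have "\<dots> = 2 * card E"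
    using assms by (subst sum.cong[OF refl, of _ _ "\<lambda>_. 2"]) (auto simp: all_edges_def)
  finally show ?thesis .
qed

lemma sum_vol_partition:
  assumes "finite V" "partition_on V \<A>"
  shows "(\<Sum>S\<in>\<A>. vol E S) = vol E V"
proof -
  have "vol E (\<Union>\<A>) = (\<Sum>S\<in>\<A>. vol E S)"
    unfolding vol_def using assms partition_onD2[OF assms(2)]
    by (subst sum.Union_disjoint)
      (auto simp: disjoint_def partition_on_def intro: finite_subset)
  then show ?thesis using assms by (simp add: partition_on_def)
qed

lemma sum_edges_inside_partition_le:
  assumes "finite V" "partition_on V \<A>" "E \<subseteq> all_edges V"
  shows "(\<Sum>S\<in>\<A>. edges_inside E S) \<le> card E"
proof -
  have fin: "finite E" using assms finite_subset[of E "Pow V"] by (auto simp: all_edges_def)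
  have finA: "finite \<A>" using assms finite_elements by blast
  have "(\<Sum>S\<in>\<A>. edges_inside E S) = card (\<Union>S\<in>\<A>. {e \<in> E. e \<subseteq> S})"
    unfolding edges_inside_def
  proof (rule card_UN_disjoint[symmetric])
    \<comment> \<open>Blocks are disjoint and edges nonempty, so no edge lies inside two blocks.
      Edges between blocks account for the inequality.\<close>
    have "e = {}" if "S \<in> \<A>" "T \<in> \<A>" "S \<noteq> T" "e \<subseteq> S" "e \<subseteq> T" for S T e
      using that partition_onD2[OF assms(2)] by (fastforce simp: disjoint_def)
    moreover have "{} \<notin> E" using assms by (auto simp: all_edges_def)
    ultimately show "\<forall>S\<in>\<A>. \<forall>T\<in>\<A>. S \<noteq> T \<longrightarrow> {e \<in> E. e \<subseteq> S} \<inter> {e \<in> E. e \<subseteq> T} = {}"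
      by blast
  qed (use fin finA in auto)
  also have "\<dots> \<le> card E" using fin by (intro card_mono) auto
  finally show ?thesis .
qed

lemma vol_le:
  assumes "finite V" "S \<subseteq> V"
  shows "vol E S \<le> vol E V"
  unfolding vol_def using assms by (intro sum_mono2) auto

lemma abs_diff_squares_le:
  fixes x y :: real
  assumes "x \<in> {0..1}" "y \<in> {0..1}"
  shows "\<bar>x\<^sup>2 - y\<^sup>2\<bar> \<le> 2 * \<bar>x - y\<bar>"
proof -
  have "\<bar>x + y\<bar> * \<bar>x - y\<bar> \<le> 2 * \<bar>x - y\<bar>"
    using assms by (intro mult_right_mono) auto
  then show ?thesis by (simp add: power2_eq_square square_diff_square_factored abs_mult)
qed

lemma sum_add_double_le:
  fixes f g :: "'i \<Rightarrow> real"
  assumes "(\<Sum>i\<in>I. f i) \<le> D" "(\<Sum>i\<in>I. g i) \<le> D"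
  shows "(\<Sum>i\<in>I. f i + 2 * g i) \<le> 3 * D"
proof -
  have "(\<Sum>i\<in>I. f i + 2 * g i) = (\<Sum>i\<in>I. f i) + 2 * (\<Sum>i\<in>I. g i)"
    by (simp add: sum.distrib sum_distrib_left)
  then show ?thesis using assms by linarith
qed

lemma diff_diff_interchange: "(a - b) - (c - d) = (a - c) - (b - d)" for a :: "'a :: ab_group_add"
  by (simp add: algebra_simps)

text \<open>For a fixed partition, the edge fractions and the volume fractions each change by at
  most \<open>2 * card (L - H) / card L\<close> in total. Squaring at most doubles the latter
  change, which gives \<open>6 = 2 + 2 * 2\<close>.\<close>

lemma modularity_score_subgraph:
  assumes V: "finite V" and L: "L \<subseteq> all_edges V" and H: "H \<subseteq> L" and A: "partition_on V \<A>"
  shows "\<bar>modularity_score V L \<A> - modularity_score V H \<A>\<bar> \<le> 6 * real (card (L - H)) / real (card L)"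
proof -
  have fin: "finite L" using V L finite_subset[of L "Pow V"] by (auto simp: all_edges_def)
  have finA: "finite \<A>" using V A finite_elements by blast
  have H': "H \<subseteq> all_edges V" and D: "L - H \<subseteq> all_edges V" using H L by auto
  have cL: "card L = card H + card (L - H)"
    using fin H finite_subset[OF H fin] by (simp add: card_Diff_subset card_mono)
  let ?x = "\<lambda>S. real (vol L S) / real (vol L V)"
  let ?y = "\<lambda>S. real (vol H S) / real (vol H V)"
  let ?u = "\<lambda>S. real (edges_inside L S) / real (card L)"
  let ?v = "\<lambda>S. real (edges_inside H S) / real (card H)"
  have edges: "(\<Sum>S\<in>\<A>. \<bar>?u S - ?v S\<bar>) \<le> 2 * real (card (L - H)) / real (card L)"
    using sum_abs_diff_normalised_le[of \<A> "\<lambda>S. real (edges_inside H S)" "\<lambda>S. real (edges_inside (L - H) S)"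
        "real (card H)" "real (card (L - H))"] finA
      sum_edges_inside_partition_le[OF V A H'] sum_edges_inside_partition_le[OF V A D]
    by (simp add: edges_inside_Diff[OF fin H] cL flip: of_nat_sum)
  have "(\<Sum>S\<in>\<A>. \<bar>?x S - ?y S\<bar>) \<le> 2 * real (vol (L - H) V) / real (vol L V)"
    using sum_abs_diff_normalised_le[of \<A> "\<lambda>S. real (vol H S)" "\<lambda>S. real (vol (L - H) S)"
        "real (vol H V)" "real (vol (L - H) V)"] finA
    by (simp add: vol_Diff[OF fin H] sum_vol_partition[OF V A] flip: of_nat_sum)
  \<comment> \<open>Total volumes are twice edge counts, so the factor 2 cancels in the
    quotient.\<close>
  then have vols: "(\<Sum>S\<in>\<A>. \<bar>?x S - ?y S\<bar>) \<le> 2 * real (card (L - H)) / real (card L)"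
    unfolding vol_all[OF V D] vol_all[OF V L] by simp
  have sq: "\<bar>(?x S)\<^sup>2 - (?y S)\<^sup>2\<bar> \<le> 2 * \<bar>?x S - ?y S\<bar>" if "S \<in> \<A>" for S
  proof -
    have "S \<subseteq> V" using that A by (auto simp: partition_on_def)
    then have "vol L S \<le> vol L V" "vol H S \<le> vol H V"
      by (auto intro: vol_le[OF V])
    moreover have "real a / real b \<in> {0..1}" if "a \<le> b" for a b :: nat
      using that by (cases "b = 0") simp_all
    ultimately show ?thesis by (intro abs_diff_squares_le)
  qed
  have eq: "modularity_score V L \<A> - modularity_score V H \<A> =
      (\<Sum>S\<in>\<A>. (?u S - ?v S) - ((?x S)\<^sup>2 - (?y S)\<^sup>2))"
    unfolding modularity_score_def sum_subtractf[symmetric]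
    by (intro sum.cong refl diff_diff_interchange)
  have "\<bar>modularity_score V L \<A> - modularity_score V H \<A>\<bar> \<le>
      (\<Sum>S\<in>\<A>. \<bar>?u S - ?v S\<bar> + 2 * \<bar>?x S - ?y S\<bar>)"
    unfolding eq
  proof (rule order.trans[OF sum_abs], rule sum_mono)
    fix S assume "S \<in> \<A>"
    then show "\<bar>(?u S - ?v S) - ((?x S)\<^sup>2 - (?y S)\<^sup>2)\<bar> \<le> \<bar>?u S - ?v S\<bar> + 2 * \<bar>?x S - ?y S\<bar>"
      by (intro order.trans[OF abs_triangle_ineq4] add_left_mono sq)
  qed
  also have "\<dots> \<le> 3 * (2 * real (card (L - H)) / real (card L))"
    by (rule sum_add_double_le[OF edges vols])
  also have "\<dots> = 6 * real (card (L - H)) / real (card L)" by simp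
  finally show ?thesis .
qed

text \<open>Both maxima run over the same finite set of partitions, so a bound uniform in the
  partition passes to them.\<close>

lemma modularity_subgraph:
  assumes V: "finite V" and L: "L \<subseteq> all_edges V" and H: "H \<subseteq> L"
  shows "\<bar>modularity V L - modularity V H\<bar> \<le> 6 * real (card (L - H)) / real (card L)"
proof -
  let ?P = "{\<A>. partition_on V \<A>}"
  let ?c = "6 * real (card (L - H)) / real (card L)"
  have fin: "finite ?P" using V by (rule finitely_many_partition_on)
  have ne: "?P \<noteq> {}" using partition_on_singletons by blast
  have le: "Max (f ` ?P) \<le> Max (g ` ?P) + ?c"
    if "\<And>\<A>. \<A> \<in> ?P \<Longrightarrow> f \<A> \<le> g \<A> + ?c" for f g :: "'a set set \<Rightarrow> real"
  proof -
    have "Max (f ` ?P) \<in> f ` ?P" using fin ne by (intro Max_in) auto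
    then obtain \<A> where A: "\<A> \<in> ?P" "Max (f ` ?P) = f \<A>" by auto
    have "g \<A> \<le> Max (g ` ?P)" using fin A by (intro Max_ge) auto
    then show ?thesis using that[OF A(1)] A(2) by simp
  qed
  have "\<bar>modularity_score V L \<A> - modularity_score V H \<A>\<bar> \<le> ?c" if "\<A> \<in> ?P" for \<A>
    using modularity_score_subgraph[OF V L H] that by auto
  then show ?thesis
    unfolding modularity_def
    using le[of "modularity_score V L" "modularity_score V H"]
      le[of "modularity_score V H" "modularity_score V L"]
    by (smt (verit))
qed

text \<open>Each graph arises from the union by deleting the edges that only the other one has; the
  two deletions together make up the symmetric difference.\<close>

lemma modularity_diff_le:
  assumes V: "finite V" and G: "G \<subseteq> all_edges V" and H: "H \<subseteq> all_edges V" "H \<noteq> {}"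
  shows "\<bar>modularity V G - modularity V H\<bar> \<le> 6 * real (card (sym_diff G H)) / real (card H)"
proof -
  let ?L = "G \<union> H"
  have L: "?L \<subseteq> all_edges V" using G H by auto
  have fin: "finite ?L" using V L finite_subset[of ?L "Pow V"] by (auto simp: all_edges_def)
  have "\<bar>modularity V G - modularity V H\<bar> \<le>
      6 * real (card (?L - G)) / real (card ?L) + 6 * real (card (?L - H)) / real (card ?L)"
    using modularity_subgraph[OF V L, of G] modularity_subgraph[OF V L, of H] by auto
  also have "\<dots> = 6 * real (card (sym_diff G H)) / real (card ?L)"
  proof -
    have "?L - G = H - G" "?L - H = G - H" by auto
    moreover have "card (sym_diff G H) = card (G - H) + card (H - G)"
      using fin by (intro card_Un_disjoint) auto
    ultimately show ?thesis by (simp add: add_divide_distrib)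
  qed
  \<comment> \<open>The union has at least as many edges as \<open>H\<close>, and
    \<open>H \<noteq> {}\<close> keeps the new denominator positive.\<close>
  also have "\<dots> \<le> 6 * real (card (sym_diff G H)) / real (card H)"
    using fin H by (intro divide_left_mono mult_pos_pos) (auto simp: card_gt_0_iff intro!: card_mono)
  finally show ?thesis .
qed

subsection \<open>The coupling\<close>

lemma one_minus_mult_le_power:
  fixes p :: real
  assumes "0 \<le> p" "p \<le> 1"
  shows "1 - real n * p \<le> (1 - p) ^ (n - 2)"
proof -
  have "1 - real n * p \<le> (1 - p) ^ n"
    using Bernoulli_inequality[of "- p" n] assms by simp
  also have "\<dots> \<le> (1 - p) ^ (n - 2)"
    using assms by (intro power_decreasing) auto
  finally show ?thesis .
qed

text \<open>\<open>q_hat n p\<close> is the probability that at least two of \<open>n\<close>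
  vertices hold a given attribute. One more vertex matters exactly when it holds the attribute
  together with exactly one of the first \<open>n\<close>.\<close>

lemma q_hat_Suc: "q_hat (Suc n) p = q_hat n p + real n * p\<^sup>2 * (1 - p) ^ (n - 1)"
  by (cases n) (simp_all add: q_hat_def power2_eq_square algebra_simps)

text \<open>By \<open>q_hat_Suc\<close>, passing to \<open>n + 1\<close> adds \<open>n\<close>
  pairs, each contributing \<open>p\<^sup>2 * (1 - p) ^ (n - 1)\<close>. This is at most
  \<open>p\<^sup>2\<close>, and exactly the weight in the lower bound at
  \<open>n + 1\<close>.\<close>

lemma q_hat_bounds:
  assumes "0 \<le> p" "p \<le> 1"
  shows "real (n choose 2) * p\<^sup>2 * (1 - p) ^ (n - 2) \<le> q_hat n p" "q_hat n p \<le> real (n choose 2) * p\<^sup>2"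
proof (induction n)
  case 0
  { case 1 show ?case by (simp add: q_hat_def numeral_2_eq_2) }
  { case 2 show ?case by (simp add: q_hat_def numeral_2_eq_2) }
next
  case (Suc n)
  have choose: "real (Suc n choose 2) = real (n choose 2) + real n"
    by (simp add: numeral_2_eq_2)
  { case 1
    have "(1 - p) ^ (n - 1) \<le> (1 - p) ^ (n - 2)"
      using assms by (intro power_decreasing) auto
    then have "real (n choose 2) * p\<^sup>2 * (1 - p) ^ (n - 1) \<le> q_hat n p"
      using Suc(1) by (meson mult_left_mono mult_nonneg_nonneg of_nat_0_le_iff order_trans zero_le_power2)
    \<comment> \<open>Truncated subtraction makes this true for \<open>n = 0\<close> too.\<close>
    moreover have "Suc n - 2 = n - 1" by simp
    ultimately show ?case by (simp only: choose q_hat_Suc) (simp add: algebra_simps) }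
  { case 2
    have "real n * p\<^sup>2 * (1 - p) ^ (n - 1) \<le> real n * p\<^sup>2 * 1"
      using assms by (intro mult_left_mono power_le_one) auto
    then show ?case using Suc(2) by (simp add: choose q_hat_Suc algebra_simps) }
qed

text \<open>\<open>l\<close> is the rate per pair and attribute in the binomial graph. Up to a
  relative error \<open>n p\<close> it agrees with \<open>p\<^sup>2\<close>, the probability that
  both ends of a pair hold the attribute.\<close>

lemma q_hat_rate_bounds:
  assumes p: "0 \<le> p" "p \<le> 1" and n: "n \<ge> 2"
  defines "l \<equiv> q_hat n p / real (n choose 2)"
  shows "p\<^sup>2 * (1 - real n * p) \<le> l" "l \<le> p\<^sup>2" "0 \<le> l"
proof -
  have N: "real (n choose 2) > 0" using n by (simp add: zero_less_binomial)
  have l: "p\<^sup>2 * (1 - p) ^ (n - 2) \<le> l" "l \<le> p\<^sup>2"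
    unfolding l_def using q_hat_bounds[OF p, of n] N
    by (simp_all add: pos_le_divide_eq pos_divide_le_eq mult_ac)
  show "l \<le> p\<^sup>2" by fact
  show "0 \<le> l" using p by (intro order.trans[OF _ l(1)]) auto
  show "p\<^sup>2 * (1 - real n * p) \<le> l"
    using one_minus_mult_le_power[OF p, of n] by (intro order.trans[OF _ l(1)] mult_left_mono) auto
qed

section \<open>Coupling for one attribute, then for all of them\<close>

text \<open>The maximal coupling gives \<open>({e}, {e})\<close> mass at least
  \<open>p\<^sup>2 * (1 - 2 * (n * p))\<close>, while \<open>e\<close> lies in either edge set with
  probability at most \<open>p\<^sup>2\<close>. Each one-sided difference thus costs at most
  \<open>2 * p\<^sup>2 * (n * p)\<close>; two of them give the constant 4.\<close>

lemma exists_clique_edges_coupling: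
  assumes p: "0 \<le> p" "p \<le> 1" and np: "real n * p \<le> 1"
  defines "q \<equiv> 1 - exp (- (q_hat n p / real (n choose 2)))"
  obtains J where "map_pmf fst J = clique_pmf n p" "map_pmf snd J = erdos_renyi_graph n q"
    "\<And>e. e \<in> all_edges {..<n} \<Longrightarrow>
       measure_pmf.prob J {(K, F). e \<in> sym_diff K F} \<le> 4 * p\<^sup>2 * (real n * p)"
proof -
  define l where "l = q_hat n p / real (n choose 2)"
  have fin: "finite (Pow (all_edges {..<n}))" by (simp add: finite_all_edges)
  obtain J where J: "map_pmf fst J = clique_pmf n p" "map_pmf snd J = erdos_renyi_graph n q"
    "\<And>x. pmf J (x, x) \<ge> min (pmf (clique_pmf n p) x) (pmf (erdos_renyi_graph n q) x)"
    using exists_coupling[of "clique_pmf n p" "erdos_renyi_graph n q"]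
      finite_subset[OF set_pmf_clique_pmf fin] finite_subset[OF set_pmf_erdos_renyi_graph fin]
    by blast
  show thesis
  proof
    show "map_pmf fst J = clique_pmf n p" "map_pmf snd J = erdos_renyi_graph n q" by fact+
    fix e assume e: "e \<in> all_edges {..<n}"
    then have "card e \<le> n" "card e = 2"
      using card_mono[of "{..<n}" e] by (auto simp: all_edges_def)
    then have n: "n \<ge> 2" by simp
    note l = q_hat_rate_bounds[OF p n, folded l_def]
    have q: "0 \<le> q" "q \<le> 1" "q \<le> l" "l * exp (- l) \<le> q"
    proof -
      show "0 \<le> q" "q \<le> 1" using l by (auto simp: q_def l_def[symmetric])
      show "q \<le> l" using exp_ge_add_one_self[of "- l"] by (simp add: q_def l_def[symmetric])
      have "(1 + l) * exp (- l) \<le> exp l * exp (- l)"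
        using exp_ge_add_one_self[of l] by (intro mult_right_mono) auto
      also have "\<dots> = 1" by (simp flip: exp_add)
      finally show "l * exp (- l) \<le> q" by (simp add: q_def l_def[symmetric] algebra_simps)
    qed
    have x0: "0 \<le> real n * p" using p by simp
    \<comment> \<open>The pair bound gives \<open>(n * p)\<close> squared, which is at most
      \<open>n * p\<close> since \<open>n * p \<le> 1\<close>.\<close>
    have qn: "q_hat n p \<le> real n * p"
    proof -
      have "real (n choose 2) \<le> (real n)\<^sup>2"
        using choose_two[of n]
        by (simp add: power2_eq_square flip: of_nat_mult)
          (meson div_le_dividend diff_le_self le_trans mult_le_mono2)
      then have "q_hat n p \<le> (real n)\<^sup>2 * p\<^sup>2"
        using q_hat_bounds(2)[OF p, of n] by (meson mult_right_mono order_trans zero_le_power2)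
      also have "\<dots> = (real n * p) * (real n * p)" by (simp add: power2_eq_square)
      also have "\<dots> \<le> (real n * p) * 1" using np x0 by (intro mult_left_mono) auto
      finally show ?thesis by simp
    qed
    have N: "(n choose 2) > 0" using n by (simp add: zero_less_binomial)
    \<comment> \<open>One factor \<open>1 - n * p\<close> is paid for by the lower bound on
      \<open>l\<close>, the other by \<open>exp (- q_hat n p)\<close>, the probability that the
      binomial edge set is empty.\<close>
    have "p\<^sup>2 * (1 - 2 * (real n * p)) \<le> p\<^sup>2 * ((1 - real n * p) * (1 - real n * p))"
      by (intro mult_left_mono) (simp_all add: left_diff_distrib right_diff_distrib)
    also have "\<dots> = p\<^sup>2 * (1 - real n * p) * (1 - real n * p)" by simp
    also have "\<dots> \<le> l * exp (- q_hat n p)"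
      using l np qn exp_ge_add_one_self[of "- q_hat n p"] by (intro mult_mono) auto
    also have "\<dots> = l * exp (- l) * exp (- l) ^ ((n choose 2) - 1)"
    proof -
      have "exp (- l) * exp (- l) ^ ((n choose 2) - 1) = exp (- l) ^ (n choose 2)"
        using N by (simp add: power_eq_if)
      also have "\<dots> = exp (- q_hat n p)"
        using N by (simp add: l_def flip: exp_of_nat_mult)
      finally show ?thesis by simp
    qed
    also have "\<dots> \<le> q * (1 - q) ^ ((n choose 2) - 1)"
    proof -
      have "1 - q = exp (- l)" by (simp add: q_def l_def)
      then show ?thesis using mult_right_mono[OF q(4), of "(1 - q) ^ ((n choose 2) - 1)"] by simp
    qed
    also have "\<dots> = pmf (erdos_renyi_graph n q) {e}"
      using pmf_erdos_renyi_graph_singleton[OF q(1,2) e] by simp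
    finally have b: "p\<^sup>2 * (1 - 2 * (real n * p)) \<le> pmf (erdos_renyi_graph n q) {e}" .
    have "1 - 2 * (real n * p) \<le> (1 - p) ^ (n - 2)"
      using one_minus_mult_le_power[OF p, of n] x0 by linarith
    then have "p\<^sup>2 * (1 - 2 * (real n * p)) \<le> p\<^sup>2 * (1 - p) ^ (n - 2)"
      by (intro mult_left_mono) auto
    also have "\<dots> \<le> pmf (clique_pmf n p) {e}"
      by (rule pmf_clique_pmf_singleton_ge[OF p e])
    finally have "p\<^sup>2 * (1 - 2 * (real n * p)) \<le> pmf J ({e}, {e})"
      using b J(3)[of "{e}"] by linarith
    also have "\<dots> \<le> measure_pmf.prob J {z. e \<in> fst z \<and> e \<in> snd z}"
      by (simp add: measure_pmf_single[symmetric] measure_pmf.finite_measure_mono)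
    finally have both: "p\<^sup>2 * (1 - 2 * (real n * p)) \<le> measure_pmf.prob J {z. e \<in> fst z \<and> e \<in> snd z}" .
    have K: "measure_pmf.prob J {z. e \<in> fst z} = p\<^sup>2"
      using prob_mem_clique_pmf[OF p e] by (simp add: J(1)[symmetric] vimage_def)
    have F: "measure_pmf.prob J {z. e \<in> snd z} = q"
      using prob_mem_erdos_renyi_graph[OF q(1,2) e] by (simp add: J(2)[symmetric] vimage_def)
    let ?X = "{z. e \<in> fst z \<and> e \<in> snd z}"
    have "measure_pmf.prob J ({z. e \<in> fst z} - ?X) = p\<^sup>2 - measure_pmf.prob J ?X"
      "measure_pmf.prob J ({z. e \<in> snd z} - ?X) = q - measure_pmf.prob J ?X"
      by (subst measure_pmf.finite_measure_Diff; auto simp: K F)+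
    moreover have "measure_pmf.prob J {(K, F). e \<in> sym_diff K F} \<le>
        measure_pmf.prob J ({z. e \<in> fst z} - ?X) + measure_pmf.prob J ({z. e \<in> snd z} - ?X)"
      by (rule order.trans[OF measure_pmf.finite_measure_mono measure_Un_le]) auto
    ultimately show "measure_pmf.prob J {(K, F). e \<in> sym_diff K F} \<le> 4 * p\<^sup>2 * (real n * p)"
      using both q l by (simp add: algebra_simps)
  qed
qed

text \<open>Independent copies of the one-attribute coupling are united componentwise. The constant
  is \<open>24 = 8 * 3\<close>: \<open>4 * p\<^sup>2 \<le> 8 * l\<close> because
  \<open>n * p \<le> 1 / 2\<close>, and \<open>exp l \<le> 3\<close> turns the exponent
  \<open>m - 1\<close> into \<open>m\<close>.\<close>

lemma exists_graph_coupling: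
  assumes p: "0 \<le> p" "p \<le> 1" and np: "real n * p \<le> 1 / 2"
  obtains J where "map_pmf fst J = random_intersection_graph n m p"
    "map_pmf snd J = erdos_renyi_graph n (p_bar n m p)"
    "\<And>e. e \<in> all_edges {..<n} \<Longrightarrow>
       measure_pmf.prob J {(G, H). e \<in> sym_diff G H} \<le> 24 * (real n * p) * p_bar n m p"
proof -
  define l where "l = q_hat n p / real (n choose 2)"
  define q where "q = 1 - exp (- l)"
  have q_hat0: "0 \<le> q_hat n p"
    using p by (intro order.trans[OF _ q_hat_bounds(1)[OF p]]) auto
  then have "l \<ge> 0" by (simp add: l_def)
  then have q: "0 \<le> q" "q \<le> 1" by (auto simp: q_def)
  have p_bar: "p_bar n m p = 1 - (1 - q) ^ m"
    by (simp add: p_bar_def q_def l_def flip: exp_of_nat_mult)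
  obtain J where J: "map_pmf fst J = clique_pmf n p" "map_pmf snd J = erdos_renyi_graph n q"
    "\<And>e. e \<in> all_edges {..<n} \<Longrightarrow>
       measure_pmf.prob J {(K, F). e \<in> sym_diff K F} \<le> 4 * p\<^sup>2 * (real n * p)"
    using exists_clique_edges_coupling[OF p, of n] np unfolding q_def l_def by auto
  define M where "M = Pi_pmf {..<m} ({}, {}) (\<lambda>_. J)"
  define U :: "(nat \<Rightarrow> nat set set \<times> nat set set) \<Rightarrow> _" where
    "U = (\<lambda>k. (\<Union>w<m. fst (k w), \<Union>w<m. snd (k w)))"
  show thesis
  proof
    have "Pi_pmf {..<m} {} (\<lambda>_. clique_pmf n p) = map_pmf ((\<circ>) fst) M"
      unfolding M_def J(1)[symmetric] by (intro Pi_pmf_map) auto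
    then show "map_pmf fst (map_pmf U M) = random_intersection_graph n m p"
      by (simp add: random_intersection_graph_eq_UN_clique_pmf pmf.map_comp o_def U_def)
    have "Pi_pmf {..<m} {} (\<lambda>_. erdos_renyi_graph n q) = map_pmf ((\<circ>) snd) M"
      unfolding M_def J(2)[symmetric] by (intro Pi_pmf_map) auto
    then show "map_pmf snd (map_pmf U M) = erdos_renyi_graph n (p_bar n m p)"
      by (simp add: p_bar erdos_renyi_graph_eq_UN[OF q] pmf.map_comp o_def U_def)
    fix e assume e: "e \<in> all_edges {..<n}"
    then have "card e \<le> n" "card e = 2"
      using card_mono[of "{..<n}" e] by (auto simp: all_edges_def)
    then have n: "n \<ge> 2" by simp
    note l = q_hat_rate_bounds[OF p n, folded l_def]
    have "measure_pmf.prob J {z. e \<in> fst z} = p\<^sup>2"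
      using prob_mem_clique_pmf[OF p e] by (simp add: J(1)[symmetric] vimage_def)
    then have "measure_pmf.prob J {(K, F). e \<notin> K} = 1 - p\<^sup>2"
      using measure_pmf.prob_compl[of "{z. e \<in> fst z}" J]
      by (simp add: Compl_eq_Diff_UNIV[symmetric] Collect_neg_eq[symmetric] case_prod_unfold)
    \<comment> \<open>Since \<open>l \<le> p\<^sup>2\<close>, the clique misses \<open>e\<close> no
      more often than the binomial edge set does, so one bound serves both kinds.\<close>
    also have "\<dots> \<le> exp (- l)"
      using l exp_ge_add_one_self[of "- l"] by linarith
    finally have K: "measure_pmf.prob J {(K, F). e \<notin> K} \<le> exp (- l)" .
    have "measure_pmf.prob J {z. e \<in> snd z} = q"
      using prob_mem_erdos_renyi_graph[OF q e] by (simp add: J(2)[symmetric] vimage_def)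
    then have F: "measure_pmf.prob J {(K, F). e \<notin> F} \<le> exp (- l)"
      using measure_pmf.prob_compl[of "{z. e \<in> snd z}" J]
      by (simp add: Compl_eq_Diff_UNIV[symmetric] Collect_neg_eq[symmetric] case_prod_unfold q_def)
    have "p\<^sup>2 * (1 / 2) \<le> p\<^sup>2 * (1 - real n * p)"
      using np by (intro mult_left_mono) auto
    then have pl: "p\<^sup>2 \<le> 2 * l" using l by linarith
    have "p\<^sup>2 \<le> 1" using p by (simp add: power_le_one)
    then have "exp l \<le> exp 1" using l by simp
    then have el: "exp l \<le> 3" using exp_le by linarith
    have "measure_pmf.prob (map_pmf U M) {(G, H). e \<in> sym_diff G H} \<le>
        real m * measure_pmf.prob J {(K, F). e \<in> sym_diff K F} * exp (- l) ^ (m - 1)"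
      using prob_mem_sym_diff_UN_le[OF K F, of m "({}, {})"]
      by (simp add: U_def M_def vimage_def case_prod_unfold)
    also have "\<dots> \<le> real m * (8 * l * (real n * p)) * exp (- l) ^ (m - 1)"
    proof -
      have *: "4 * p\<^sup>2 * (real n * p) \<le> 8 * l * (real n * p)"
        using pl p by (intro mult_right_mono) auto
      show ?thesis
        by (intro mult_right_mono mult_left_mono order.trans[OF J(3)[OF e] *]) auto
    qed
    also have "\<dots> = 8 * (real n * p) * (real m * l * exp (- l) ^ (m - 1))" by simp
    also have "\<dots> \<le> 8 * (real n * p) * (3 * p_bar n m p)"
    proof (rule mult_left_mono)
      \<comment> \<open>For \<open>m = 0\<close> the exponent is truncated, but both sides
        vanish.\<close>
      have "real m * l * exp (- l) ^ (m - 1) = exp l * (real m * l * exp (- (real m * l)))"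
      proof (cases m)
        case (Suc k)
        then show ?thesis by (simp add: algebra_simps flip: exp_of_nat_mult exp_add)
      qed simp
      also have "\<dots> \<le> 3 * (real m * l * exp (- (real m * l)))"
        using el l by (intro mult_right_mono) auto
      \<comment> \<open>With \<open>t = m * l\<close> this is
        \<open>(1 + t) * exp (- t) \<le> 1\<close>; it keeps the bound proportional to
        \<open>p_bar\<close> for large \<open>t\<close> as well.\<close>
      also have "real m * l * exp (- (real m * l)) \<le> 1 - exp (- (real m * l))"
      proof -
        have "(1 + real m * l) * exp (- (real m * l)) \<le> exp (real m * l) * exp (- (real m * l))"
          using exp_ge_add_one_self[of "real m * l"] by (intro mult_right_mono) auto
        also have "\<dots> = 1" by (simp flip: exp_add)
        finally show ?thesis by (simp add: algebra_simps)
      qed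
      also have "\<dots> = p_bar n m p" by (simp add: p_bar_def l_def)
      finally show "real m * l * exp (- l) ^ (m - 1) \<le> 3 * p_bar n m p" by simp
    qed (use p in auto)
    finally show "measure_pmf.prob (map_pmf U M) {(G, H). e \<in> sym_diff G H} \<le>
        24 * (real n * p) * p_bar n m p" by simp
  qed
qed

section \<open>Edge counts: lower tail and symmetric difference\<close>

text \<open>Markov's inequality for \<open>exp (- card H)\<close>. Each pair contributes a factor
  \<open>1 - q * (1 - exp (- 1)) \<le> exp (- (q / 2))\<close> to the expectation, in total at most
  \<open>exp (- (\<mu> / 2))\<close>; the threshold \<open>exp (- (\<mu> / 4))\<close> uses up half
  of the exponent.\<close>

lemma prob_card_erdos_renyi_graph_le:
  fixes n :: nat
  assumes q: "0 \<le> q" "q \<le> 1"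
  defines "\<mu> \<equiv> real (n choose 2) * q"
  shows "measure_pmf.prob (erdos_renyi_graph n q) {H. real (card H) \<le> \<mu> / 4} \<le> exp (- (\<mu> / 4))"
proof -
  let ?E = "all_edges {..<n}"
  let ?M = "Pi_pmf ?E False (\<lambda>_. bernoulli_pmf q)"
  \<comment> \<open>Written as a product over pairs, \<open>exp (- card H)\<close> has an
    expectation that factors by independence.\<close>
  let ?u = "\<lambda>f. \<Prod>e\<in>?E. if f e then exp (- 1 :: real) else 1"
  have E: "finite ?E" "card ?E = n choose 2" by (simp_all add: finite_all_edges card_all_edges)
  have u: "?u f = exp (- real (card {e \<in> ?E. f e}))" for f
    using E by (simp add: prod.If_cases Int_def flip: exp_of_nat_mult)
  have "q * exp (- 1) \<le> q * (1 / 2)"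
    using exp_ge_add_one_self[of "1 :: real"] q by (intro mult_left_mono) (auto simp: exp_minus field_simps)
  then have "exp (- 1) * q + (1 - q) \<le> exp (- (q / 2))"
    using exp_ge_add_one_self[of "- (q / 2)"] by (simp add: mult.commute)
  then have "(exp (- 1) * q + (1 - q)) ^ (n choose 2) \<le> exp (- (q / 2)) ^ (n choose 2)"
    using q by (intro power_mono) auto
  moreover have "measure_pmf.expectation ?M ?u = (exp (- 1) * q + (1 - q)) ^ (n choose 2)"
    using E q by (subst expectation_prod_Pi_pmf) (auto intro: integrable_measure_pmf_finite)
  moreover have "exp (- (q / 2)) ^ (n choose 2) = exp (- (\<mu> / 2))"
    by (simp add: \<mu>_def mult.commute flip: exp_of_nat_mult)
  ultimately have exp_u: "measure_pmf.expectation ?M ?u \<le> exp (- (\<mu> / 2))" by simp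
  have "measure_pmf.prob (erdos_renyi_graph n q) {H. real (card H) \<le> \<mu> / 4} =
      measure_pmf.prob ?M {f \<in> space ?M. ?u f \<ge> exp (- (\<mu> / 4))}"
    unfolding u by (simp add: erdos_renyi_graph_def vimage_def)
  also have "\<dots> \<le> measure_pmf.expectation ?M ?u / exp (- (\<mu> / 4))"
  proof (rule integral_Markov_inequality_measure[where A="{}"])
    show "integrable ?M ?u"
      unfolding u by (rule measure_pmf.integrable_const_bound[where B=1]) auto
  qed (auto simp: u)
  also have "\<dots> \<le> exp (- (\<mu> / 2)) / exp (- (\<mu> / 4))"
    using exp_u by (intro divide_right_mono) auto
  also have "\<dots> = exp (- (\<mu> / 4))"
    by (simp flip: exp_diff)
  finally show ?thesis .
qed

text \<open>Linearity of expectation over indicators; the decomposition holds on the support, hence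
  almost surely.\<close>

lemma expectation_card_eq_sum_prob:
  assumes "finite E" "\<And>x. x \<in> set_pmf J \<Longrightarrow> D x \<subseteq> E"
  shows "integrable J (\<lambda>x. real (card (D x)))"
    "measure_pmf.expectation J (\<lambda>x. real (card (D x))) = (\<Sum>e\<in>E. measure_pmf.prob J {x. e \<in> D x})"
proof -
  have ae: "AE x in J. real (card (D x)) = (\<Sum>e\<in>E. indicator {x. e \<in> D x} x)"
  proof (rule AE_pmfI)
    fix x assume "x \<in> set_pmf J"
    then have "D x = {e \<in> E. e \<in> D x}" using assms by auto
    then show "real (card (D x)) = (\<Sum>e\<in>E. indicator {x. e \<in> D x} x)"
      using assms(1) by (simp add: indicator_def sum.If_cases Int_def)
  qed
  show "integrable J (\<lambda>x. real (card (D x)))"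
    by (subst integrable_cong_AE[OF _ _ ae])
      (auto intro!: Bochner_Integration.integrable_sum integrable_real_indicator
        simp: measure_pmf.emeasure_finite less_top[symmetric])
  have "measure_pmf.expectation J (\<lambda>x. real (card (D x))) =
      measure_pmf.expectation J (\<lambda>x. \<Sum>e\<in>E. indicator {x. e \<in> D x} x)"
    by (rule integral_cong_AE[OF _ _ ae]) auto
  then show "measure_pmf.expectation J (\<lambda>x. real (card (D x))) =
      (\<Sum>e\<in>E. measure_pmf.prob J {x. e \<in> D x})"
    by (subst (asm) Bochner_Integration.integral_sum)
      (auto intro!: integrable_real_indicator simp: measure_pmf.emeasure_finite less_top[symmetric])
qed

lemma set_pmf_random_intersection_graph:
  "set_pmf (random_intersection_graph n m p) \<subseteq> Pow (all_edges {..<n})"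
  by (auto simp: random_intersection_graph_def intersection_edges_def all_edges_def)

text \<open>With \<open>\<mu>\<close> the mean number of edges of \<open>H\<close>, the split is at
  \<open>\<mu> * sqrt x = 1\<close>. Below it the expected symmetric difference is at most
  \<open>C * x * \<mu> \<le> C * sqrt x\<close>, so the graphs mostly coincide. Above it
  \<open>H\<close> has more than \<open>\<mu> / 4\<close> edges except with probability
  \<open>4 / \<mu> \<le> 4 * sqrt x\<close>, and Markov's inequality controls the relative
  difference.\<close>

lemma prob_sym_diff_large_le:
  fixes J :: "(nat set set \<times> nat set set) pmf" and n :: nat
  defines "E \<equiv> all_edges {..<n}"
  assumes J: "map_pmf fst J = random_intersection_graph n m p" "map_pmf snd J = erdos_renyi_graph n q"
    and e: "\<And>e. e \<in> E \<Longrightarrow> measure_pmf.prob J {(G, H). e \<in> sym_diff G H} \<le> C * x * q"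
    and q: "0 \<le> q" "q \<le> 1" and x: "0 \<le> x" and C: "0 \<le> C"
  shows "measure_pmf.prob J {(G, H). \<not> (G \<subseteq> E \<and> H \<subseteq> E \<and> (G = H \<or>
      H \<noteq> {} \<and> real (card (sym_diff G H)) \<le> x powr (1 - \<delta>) * real (card H)))} \<le>
    (C + 4) * sqrt x + 4 * C * x powr \<delta>"
    (is "measure_pmf.prob J ?B \<le> _")
proof -
  define N where "N = real (n choose 2)"
  define \<mu> where "\<mu> = N * q"
  let ?D = "\<lambda>z :: nat set set \<times> nat set set. sym_diff (fst z) (snd z)"
  have N: "N \<ge> 0" "real (card E) = N" by (simp_all add: N_def E_def card_all_edges)
  have fin: "finite E" by (simp add: E_def finite_all_edges)
  have sub: "fst z \<subseteq> E" "snd z \<subseteq> E" if "z \<in> set_pmf J" for z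
  proof -
    have "fst z \<in> set_pmf (map_pmf fst J)" "snd z \<in> set_pmf (map_pmf snd J)" using that by auto
    then show "fst z \<subseteq> E" "snd z \<subseteq> E"
      unfolding J E_def using set_pmf_random_intersection_graph set_pmf_erdos_renyi_graph by blast+
  qed
  then have subD: "?D z \<subseteq> E" if "z \<in> set_pmf J" for z using that by blast
  have markov: "measure_pmf.prob J {z. real (card (?D z)) \<ge> c} \<le> C * x * \<mu> / c" if "c > 0" for c
  proof -
    have "measure_pmf.prob J {z \<in> space J. real (card (?D z)) \<ge> c} \<le>
        measure_pmf.expectation J (\<lambda>z. real (card (?D z))) / c"
      using that expectation_card_eq_sum_prob(1)[OF fin subD]
      by (intro integral_Markov_inequality_measure[where A="{}"]) auto
    also have "measure_pmf.expectation J (\<lambda>z. real (card (?D z))) \<le> (\<Sum>e\<in>E. C * x * q)"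
    proof (subst expectation_card_eq_sum_prob(2)[OF fin subD])
      show "(\<Sum>d\<in>E. measure_pmf.prob J {z. d \<in> ?D z}) \<le> (\<Sum>d\<in>E. C * x * q)"
        using e by (intro sum_mono) (simp add: case_prod_unfold)
    qed
    also have "\<dots> = C * x * \<mu>" by (simp add: N \<mu>_def)
    finally show ?thesis using that by (simp add: divide_right_mono)
  qed
  have \<mu>0: "\<mu> \<ge> 0" using N q by (simp add: \<mu>_def)
  show ?thesis
  proof (cases "\<mu> * sqrt x \<le> 1")
    case True
    have "measure_pmf.prob J ?B \<le> measure_pmf.prob J {z. real (card (?D z)) \<ge> 1}"
    proof (rule measure_pmf.finite_measure_mono_AE, rule AE_pmfI, rule impI)
      fix z assume z: "z \<in> set_pmf J" "z \<in> ?B"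
      then have "?D z \<noteq> {}" using sub[OF z(1)] by (auto simp: case_prod_unfold)
      moreover have "finite (?D z)" using subD[OF z(1)] fin finite_subset by blast
      ultimately have "card (?D z) > 0" by (meson card_gt_0_iff)
      then show "z \<in> {z. real (card (?D z)) \<ge> 1}" by simp
    qed simp
    also have "\<dots> \<le> C * x * \<mu>" using markov[of 1] by simp
    also have "\<dots> = C * sqrt x * (\<mu> * sqrt x)" using x by simp
    also have "\<dots> \<le> C * sqrt x * 1" using True C x by (intro mult_left_mono) auto
    also have "\<dots> \<le> (C + 4) * sqrt x + 4 * C * x powr \<delta>"
      using C x by (simp add: distrib_right)
    finally show ?thesis .
  next
    case False
    then have pos: "x > 0" "\<mu> > 0" using x \<mu>0 by (auto simp: less_le)
    \<comment> \<open>The permitted fraction of the \<open>\<mu> / 4\<close> edges that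
      \<open>H\<close> typically exceeds; Markov's inequality at \<open>c\<close> leaves
      \<open>4 * C * x powr \<delta>\<close>.\<close>
    define c where "c = x powr (1 - \<delta>) * (\<mu> / 4)"
    have c: "c > 0" using pos by (simp add: c_def)
    let ?S = "{z :: nat set set \<times> nat set set. real (card (snd z)) \<le> \<mu> / 4}"
    let ?T = "{z. real (card (?D z)) \<ge> c}"
    have "measure_pmf.prob J ?B \<le> measure_pmf.prob J (?S \<union> ?T)"
    proof (rule measure_pmf.finite_measure_mono_AE, rule AE_pmfI, rule impI)
      fix z assume z: "z \<in> set_pmf J" "z \<in> ?B"
      show "z \<in> ?S \<union> ?T"
      proof (rule ccontr)
        assume "z \<notin> ?S \<union> ?T"
        then have large: "real (card (snd z)) > \<mu> / 4" "real (card (?D z)) < c" by auto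
        then have "snd z \<noteq> {}" using pos by auto
        moreover have "c \<le> x powr (1 - \<delta>) * real (card (snd z))"
          unfolding c_def using large by (intro mult_left_mono) auto
        ultimately show False using z(2) sub[OF z(1)] large by (auto simp: case_prod_unfold)
      qed
    qed simp
    also have "\<dots> \<le> measure_pmf.prob J ?S + measure_pmf.prob J ?T"
      by (intro measure_Un_le) auto
    also have "measure_pmf.prob J ?T \<le> 4 * C * x powr \<delta>"
    proof -
      have "x = x powr (1 - \<delta>) * x powr \<delta>" using pos by (simp flip: powr_add)
      then have "C * x * \<mu> / c = 4 * C * x powr \<delta>"
        using pos by (simp add: c_def field_simps)
      then show ?thesis using markov[OF c] by simp
    qed
    also have "measure_pmf.prob J ?S \<le> 4 * sqrt x"
    proof -
      have "measure_pmf.prob J ?S \<le> exp (- (\<mu> / 4))"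
        using prob_card_erdos_renyi_graph_le[OF q, of n]
        by (simp add: J(2)[symmetric] vimage_def \<mu>_def N_def)
      also have "\<dots> \<le> 4 / \<mu>"
        using exp_ge_add_one_self[of "\<mu> / 4"] pos
        by (simp add: exp_minus field_simps)
      also have "\<dots> \<le> 4 * sqrt x"
        using False pos by (simp add: field_simps)
      finally show ?thesis .
    qed
    also have "4 * sqrt x + 4 * C * x powr \<delta> \<le> (C + 4) * sqrt x + 4 * C * x powr \<delta>"
      using C x by (intro add_right_mono mult_right_mono) auto
    finally show ?thesis by simp
  qed
qed

section \<open>Assembly along the sequence\<close>

lemma p_bar_bounds:
  assumes "0 \<le> p" "p \<le> 1"
  shows "0 \<le> p_bar n m p" "p_bar n m p \<le> 1"
proof -
  have "0 \<le> q_hat n p"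
    using assms by (intro order.trans[OF _ q_hat_bounds(1)[OF assms]]) auto
  then show "0 \<le> p_bar n m p" by (simp add: p_bar_def)
  show "p_bar n m p \<le> 1" by (simp add: p_bar_def)
qed

theorem theorem4:
  fixes m :: "nat \<Rightarrow> nat" and p :: "nat \<Rightarrow> real" and \<delta> :: real
  assumes "\<And>n. 0 \<le> p n \<and> p n \<le> 1"
    and "filterlim m at_top sequentially"
    and "p \<longlonglongrightarrow> 0"
    and "(\<lambda>n. real n * p n) \<in> o(\<lambda>_. 1)"
    and "\<delta> > 0"
  shows "\<exists>J :: nat \<Rightarrow> (nat set set \<times> nat set set) pmf.
    (\<forall>n. map_pmf fst (J n) = random_intersection_graph n (m n) (p n) \<and>
         map_pmf snd (J n) = erdos_renyi_graph n (p_bar n (m n) (p n))) \<and>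
    (\<exists>\<epsilon> R :: nat \<Rightarrow> real.
       \<epsilon> \<in> o(\<lambda>_. 1) \<and> R \<in> O(\<lambda>n. (real n * p n) powr (1 - \<delta>)) \<and>
       (\<lambda>n. measure_pmf.prob (J n)
          {(G, H). \<exists>a b. \<bar>a\<bar> \<le> \<epsilon> n \<and> \<bar>b\<bar> \<le> R n \<and>
             modularity {..<n} G = (1 + a) * modularity {..<n} H + b}) \<longlonglongrightarrow> 1)"
proof -
  define x where "x n = real n * p n" for n
  define q where "q n = p_bar n (m n) (p n)" for n
  have p: "0 \<le> p n" "p n \<le> 1" for n using assms(1) by auto
  have x0: "0 \<le> x n" for n using p by (simp add: x_def)
  have x_lim: "x \<longlonglongrightarrow> 0"
    using smalloD_tendsto[OF assms(4)] by (simp add: x_def[abs_def])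
  \<comment> \<open>The edge bound is available once \<open>x n \<le> 1 / 2\<close>, so for all
    large \<open>n\<close>. As a coupling is demanded for every \<open>n\<close>, the remaining ones
    ask for the marginals alone, which an independent pair provides.\<close>
  define Coupling where "Coupling n J \<longleftrightarrow>
      map_pmf fst J = random_intersection_graph n (m n) (p n) \<and>
      map_pmf snd J = erdos_renyi_graph n (q n) \<and>
      (x n \<le> 1 / 2 \<longrightarrow> (\<forall>e\<in>all_edges {..<n}.
        measure_pmf.prob J {(G, H). e \<in> sym_diff G H} \<le> 24 * x n * q n))" for n J
  have "\<exists>J. Coupling n J" for n
  proof (cases "x n \<le> 1 / 2")
    case True
    then obtain J where "map_pmf fst J = random_intersection_graph n (m n) (p n)"
      "map_pmf snd J = erdos_renyi_graph n (q n)"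
      "\<And>e. e \<in> all_edges {..<n} \<Longrightarrow>
        measure_pmf.prob J {(G, H). e \<in> sym_diff G H} \<le> 24 * x n * q n"
      using exists_graph_coupling[OF p, of n n "m n"] unfolding x_def q_def by blast
    then have "Coupling n J" unfolding Coupling_def by blast
    then show ?thesis ..
  next
    case False
    then have "Coupling n (pair_pmf (random_intersection_graph n (m n) (p n)) (erdos_renyi_graph n (q n)))"
      unfolding Coupling_def by (simp add: map_fst_pair_pmf map_snd_pair_pmf)
    then show ?thesis ..
  qed
  then obtain J where "\<And>n. Coupling n (J n)"
    using choice[of Coupling] by blast
  then have J: "map_pmf fst (J n) = random_intersection_graph n (m n) (p n)"
    "map_pmf snd (J n) = erdos_renyi_graph n (q n)"
    "x n \<le> 1 / 2 \<Longrightarrow> e \<in> all_edges {..<n} \<Longrightarrow>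
      measure_pmf.prob (J n) {(G, H). e \<in> sym_diff G H} \<le> 24 * x n * q n" for n e
    unfolding Coupling_def by blast+
  \<comment> \<open>The factor 6 is that of \<open>modularity_diff_le\<close>.\<close>
  define R where "R n = 6 * x n powr (1 - \<delta>)" for n
  \<comment> \<open>The multiplicative error is set to zero; \<open>b\<close> absorbs the whole
    difference.\<close>
  define Good where "Good n = {(G, H). \<exists>a b. \<bar>a\<bar> \<le> (0::real) \<and> \<bar>b\<bar> \<le> R n \<and>
    modularity {..<n} G = (1 + a) * modularity {..<n} H + b}" for n
  have good: "1 - (28 * sqrt (x n) + 96 * x n powr \<delta>) \<le> measure_pmf.prob (J n) (Good n)"
    if small: "x n \<le> 1 / 2" for n
  proof -
    let ?E = "all_edges {..<n}"
    let ?B = "{(G, H). \<not> (G \<subseteq> ?E \<and> H \<subseteq> ?E \<and> (G = H \<or>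
      H \<noteq> {} \<and> real (card (sym_diff G H)) \<le> x n powr (1 - \<delta>) * real (card H)))}"
    have "- ?B \<subseteq> Good n"
    proof
      fix z assume z: "z \<in> - ?B"
      obtain G H where [simp]: "z = (G, H)" by (cases z)
      have GH: "G \<subseteq> ?E" "H \<subseteq> ?E" using z by auto
      have "\<bar>modularity {..<n} G - modularity {..<n} H\<bar> \<le> R n"
      proof (cases "G = H")
        case True
        then show ?thesis by (simp add: R_def)
      next
        case False
        then have H: "H \<noteq> {}" "real (card (sym_diff G H)) \<le> x n powr (1 - \<delta>) * real (card H)"
          using z by auto
        have "card H > 0"
          using H GH finite_subset[of H ?E] by (simp add: card_gt_0_iff finite_all_edges)
        then have "6 * real (card (sym_diff G H)) / real (card H) \<le> R n"
          using H(2) by (simp add: R_def divide_le_eq)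
        then show ?thesis
          using modularity_diff_le[of "{..<n}" G H] GH H(1) by simp
      qed
      then show "z \<in> Good n"
        by (auto simp: Good_def intro!: exI[of _ "0::real"] exI[of _ "modularity {..<n} G - modularity {..<n} H"])
    qed
    then have "measure_pmf.prob (J n) (- ?B) \<le> measure_pmf.prob (J n) (Good n)"
      by (intro measure_pmf.finite_measure_mono) auto
    moreover have "measure_pmf.prob (J n) (- ?B) = 1 - measure_pmf.prob (J n) ?B"
      using measure_pmf.prob_compl[of ?B "J n"] by (simp add: Compl_eq_Diff_UNIV)
    \<comment> \<open>\<open>C = 24\<close> is the constant of \<open>exists_graph_coupling\<close>;
      it produces 28 and 96.\<close>
    moreover have "measure_pmf.prob (J n) ?B \<le> (24 + 4) * sqrt (x n) + 4 * 24 * x n powr \<delta>"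
      using J(3)[OF small] p_bar_bounds[OF p[of n]] x0
      by (intro prob_sym_diff_large_le[OF J(1) J(2)]) (auto simp: q_def)
    ultimately show ?thesis by simp
  qed
  have "(\<lambda>n. measure_pmf.prob (J n) (Good n)) \<longlonglongrightarrow> 1"
  proof (rule tendsto_sandwich)
    have "(\<lambda>n. sqrt (x n)) \<longlonglongrightarrow> sqrt 0" by (intro tendsto_intros x_lim)
    \<comment> \<open>Here \<open>\<delta> > 0\<close> makes the failure probability vanish; giving
      up \<open>\<delta>\<close> in the exponent of \<open>R\<close> pays for it.\<close>
    moreover have "(\<lambda>n. x n powr \<delta>) \<longlonglongrightarrow> 0"
      using assms(5) x0 by (intro tendsto_zero_powrI[OF x_lim tendsto_const]) auto
    ultimately have "(\<lambda>n. 1 - (28 * sqrt (x n) + 96 * x n powr \<delta>)) \<longlonglongrightarrow> 1 - (28 * sqrt 0 + 96 * 0)"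
      by (intro tendsto_intros x_lim)
    then show "(\<lambda>n. 1 - (28 * sqrt (x n) + 96 * x n powr \<delta>)) \<longlonglongrightarrow> 1" by simp
    have "\<forall>\<^sub>F n in sequentially. x n < 1 / 2"
      using x_lim by (rule order_tendstoD) simp
    then show "\<forall>\<^sub>F n in sequentially. 1 - (28 * sqrt (x n) + 96 * x n powr \<delta>) \<le>
        measure_pmf.prob (J n) (Good n)"
      by eventually_elim (auto intro: good)
    show "\<forall>\<^sub>F n in sequentially. measure_pmf.prob (J n) (Good n) \<le> 1" by simp
  qed simp
  moreover have "R \<in> O(\<lambda>n. (real n * p n) powr (1 - \<delta>))"
    unfolding R_def x_def by simp
  moreover have "(\<lambda>_. 0 :: real) \<in> o(\<lambda>_::nat. 1 :: real)" by simp
  moreover have "\<forall>n. map_pmf fst (J n) = random_intersection_graph n (m n) (p n) \<and>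
      map_pmf snd (J n) = erdos_renyi_graph n (p_bar n (m n) (p n))"
    using J(1,2) unfolding q_def by blast
  ultimately show ?thesis
    unfolding Good_def by (intro exI[of _ J] conjI exI[of _ "\<lambda>_. 0"] exI[of _ R])
qed

end
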